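(* Every digraph $G=(V,E)$ with finite vertex set $V$ has a unique decomposition whose components are intervals (i.e. a unique decomposition in which the vertex set of every component is an interval).
   Context: A digraph is a pair $G=(V,E)$ with $E\subseteq V\times V$ (loops allowed). For $v\in V$, $\mathrm{D}^-(v)=\{u\in V\mid (u,v)\in E\}$. The inflation of $U\subseteq V$ is $\mathrm{Inf}\,U=U\cup\{v\in V\mid \varnothing\ne \mathrm{D}^-(v)\subseteq U\}$; put $\mathrm{Inf}^0U=U$, $\mathrm{Inf}^{n}U=\mathrm{Inf}(\mathrm{Inf}^{n-1}U)$, and $\mathrm{Inf}^\infty U=\bigcup_{n\ge0}\mathrm{Inf}^nU$. A set of the form $\mathrm{Inf}^\infty U'$ is called a hyperinflation. A decomposition of $G$ is a set of subgraphs $G_i=(V_i,E_i)$ ($i\in I$) such that the $V_i$ are hyperinflations, $V$ is the disjoint union of the $V_i$, and $E_i$ is the restriction of $E$ to $V_i$. A subset $U\subseteq V$ is a region if $U=\mathrm{Inf}^\infty\{x\}$ for some $x\in V$; a region is an interval if it is not contained in any other region. *)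

theory Defs
  imports "Graph_Theory.Graph_Theory" "HOL-Library.Disjoint_Sets"
begin

definition in_nbrs :: "'a pair_pre_digraph \<Rightarrow> 'a \<Rightarrow> 'a set" where
  "in_nbrs G v = {u \<in> pverts G. (u, v) \<in> parcs G}"

definition inflation :: "'a pair_pre_digraph \<Rightarrow> 'a set \<Rightarrow> 'a set" where
  "inflation G U = U \<union> {v \<in> pverts G. in_nbrs G v \<noteq> {} \<and> in_nbrs G v \<subseteq> U}"

definition inflation_inf :: "'a pair_pre_digraph \<Rightarrow> 'a set \<Rightarrow> 'a set" where
  "inflation_inf G U = (\<Union>n. (inflation G ^^ n) U)"

definition hyperinflation :: "'a pair_pre_digraph \<Rightarrow> 'a set \<Rightarrow> bool" where
  "hyperinflation G U \<longleftrightarrow> (\<exists>U' \<subseteq> pverts G. U = inflation_inf G U')"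

text \<open>The components form a set of subgraphs, not a family, so disjointness is required of
  distinct members. The library's induced_subgraph says that the arcs of a component are exactly
  the arcs of G with both ends in the component.\<close>

definition decomposition :: "'a pair_pre_digraph \<Rightarrow> 'a pair_pre_digraph set \<Rightarrow> bool" where
  "decomposition G D \<longleftrightarrow>
     (\<forall>H\<in>D. induced_subgraph (with_proj H) (with_proj G) \<and> hyperinflation G (pverts H)) \<and>
     disjoint_family_on pverts D \<and> (\<Union>H\<in>D. pverts H) = pverts G"

definition region :: "'a pair_pre_digraph \<Rightarrow> 'a set \<Rightarrow> bool" where
  "region G U \<longleftrightarrow> (\<exists>x \<in> pverts G. U = inflation_inf G {x})"

definition interval :: "'a pair_pre_digraph \<Rightarrow> 'a set \<Rightarrow> bool" where
  "interval G U \<longleftrightarrow> region G U \<and> \<not> (\<exists>W. region G W \<and> W \<noteq> U \<and> U \<subseteq> W)"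

end

theory Submission
  imports Defs
begin

text \<open>If \<open>z\<close> lies in the regions generated by \<open>x\<close> and \<open>y\<close> and is neither generator, then all
  in-neighbours of \<open>z\<close> lie in both regions and occur in the inflation process from \<open>x\<close> earlier
  than \<open>z\<close>. Descending along them ends at a generator, so regions that meet are nested and
  intervals that meet are equal. By finiteness every region extends to an interval, so the
  intervals partition the vertices, and a decomposition into intervals has to use all of them.\<close>

lemma in_inflation_iff:
  "v \<in> inflation G U \<longleftrightarrow>
    v \<in> U \<or> v \<in> pverts G \<and> in_nbrs G v \<noteq> {} \<and> in_nbrs G v \<subseteq> U"
  by (simp add: inflation_def)

lemma inflation_mono: "U \<subseteq> W \<Longrightarrow> inflation G U \<subseteq> inflation G W"
  unfolding inflation_def by blast

lemma incseq_inflation: "incseq (\<lambda>n. (inflation G ^^ n) U)"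
  by (rule incseq_SucI) (auto simp: in_inflation_iff)

lemma subset_inflation_inf: "U \<subseteq> inflation_inf G U"
proof -
  have "(inflation G ^^ 0) U \<subseteq> inflation_inf G U" unfolding inflation_inf_def by blast
  then show ?thesis by simp
qed

lemma inflation_inf_subset_verts:
  assumes "U \<subseteq> pverts G"
  shows "inflation_inf G U \<subseteq> pverts G"
proof -
  have "(inflation G ^^ n) U \<subseteq> pverts G" for n
    using assms by (induction n) (auto simp: in_inflation_iff)
  then show ?thesis unfolding inflation_inf_def by blast
qed

text \<open>Each element of \<open>A\<close> enters at some stage, and the largest of these finitely
  many stages contains them all.\<close>

lemma finite_subset_incseq_UN:
  assumes "incseq S" "finite A" "A \<subseteq> (\<Union>n::nat. S n)"
  shows "\<exists>n. A \<subseteq> S n"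
  using assms(2,3)
proof (induction A rule: finite_induct)
  case (insert a A)
  then obtain m n where "a \<in> S m" "A \<subseteq> S n" by auto
  moreover have "S m \<subseteq> S (max m n)" "S n \<subseteq> S (max m n)"
    using \<open>incseq S\<close> by (auto simp: incseq_def)
  ultimately have "insert a A \<subseteq> S (max m n)" by blast
  then show ?case by blast
qed simp

text \<open>A finite in-neighbourhood inside the union already lies in a single stage, so its vertex
  joins at the next one. An infinite in-neighbourhood could be exhausted only in the limit, after
  all stages.\<close>

lemma inflation_inflation_inf_subset:
  assumes "finite (pverts G)"
  shows "inflation G (inflation_inf G U) \<subseteq> inflation_inf G U"
proof
  fix v assume v: "v \<in> inflation G (inflation_inf G U)"
  show "v \<in> inflation_inf G U"
  proof (cases "v \<in> inflation_inf G U")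
    case False
    then have *: "v \<in> pverts G" "in_nbrs G v \<noteq> {}" "in_nbrs G v \<subseteq> inflation_inf G U"
      using v by (auto simp: in_inflation_iff)
    have "finite (in_nbrs G v)" using assms by (simp add: in_nbrs_def)
    then obtain n where "in_nbrs G v \<subseteq> (inflation G ^^ n) U"
      using finite_subset_incseq_UN[OF incseq_inflation] *(3) unfolding inflation_inf_def by blast
    then have "v \<in> (inflation G ^^ Suc n) U" using * by (simp add: in_inflation_iff)
    then show ?thesis unfolding inflation_inf_def by blast
  qed
qed

text \<open>A hyperinflation is closed under inflation, so every stage started inside it stays
  inside. For singletons this turns membership of a generator into inclusion of regions.\<close>

lemma inflation_inf_least:
  assumes "finite (pverts G)" "W \<subseteq> inflation_inf G U"
  shows "inflation_inf G W \<subseteq> inflation_inf G U"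
proof -
  have "(inflation G ^^ n) W \<subseteq> inflation_inf G U" for n
  proof (induction n)
    case (Suc n)
    have "(inflation G ^^ Suc n) W \<subseteq> inflation G (inflation_inf G U)"
      using inflation_mono[OF Suc] by simp
    then show ?case using inflation_inflation_inf_subset[OF assms(1)] by (rule subset_trans)
  qed (simp add: assms(2))
  then show ?thesis unfolding inflation_inf_def by blast
qed

text \<open>A vertex outside \<open>U\<close> can only have entered through the inflation rule,
  which requires its in-neighbours to be present one stage earlier.\<close>

lemma in_nbrs_subset_inflation_inf:
  assumes "v \<in> inflation_inf G U" "v \<notin> U"
  shows "in_nbrs G v \<subseteq> inflation_inf G U"
proof -
  have "v \<in> (inflation G ^^ n) U \<Longrightarrow> in_nbrs G v \<subseteq> inflation_inf G U" for n
  proof (induction n)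
    case (Suc n)
    have "(inflation G ^^ n) U \<subseteq> inflation_inf G U"
      unfolding inflation_inf_def by blast
    then show ?case using Suc by (auto simp: in_inflation_iff)
  qed (use assms(2) in simp)
  then show ?thesis using assms(1) unfolding inflation_inf_def by blast
qed

text \<open>Induction on a stage of the process from \<open>x\<close> that contains
  \<open>z\<close>; at stage 0, \<open>z\<close> is \<open>x\<close> itself. Stages are counted only
  for \<open>x\<close>: on the side of \<open>y\<close> it suffices that in-neighbours stay in the
  region.\<close>

lemma generator_in_region_if_meet:
  assumes "z \<in> inflation_inf G {x}" "z \<in> inflation_inf G {y}"
  shows "x \<in> inflation_inf G {y} \<or> y \<in> inflation_inf G {x}"
proof -
  obtain n where "z \<in> (inflation G ^^ n) {x}"
    using assms(1) unfolding inflation_inf_def by blast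
  then show ?thesis using assms
  proof (induction n arbitrary: z)
    case (Suc n)
    show ?case
    proof (cases "z = y \<or> z \<in> (inflation G ^^ n) {x}")
      case True
      then show ?thesis using Suc.IH Suc.prems(2,3) by auto
    next
      case False
      then have "in_nbrs G z \<noteq> {}" "in_nbrs G z \<subseteq> (inflation G ^^ n) {x}"
        using Suc.prems(1) by (auto simp: in_inflation_iff)
      \<comment> \<open>The descent can continue because inflation never adds a vertex without
        in-neighbours.\<close>
      then obtain u where u: "u \<in> in_nbrs G z" "u \<in> (inflation G ^^ n) {x}"
        by blast
      have "u \<in> inflation_inf G {y}"
        using in_nbrs_subset_inflation_inf[OF Suc.prems(3)] False u(1) by auto
      moreover have "u \<in> inflation_inf G {x}"
        using u(2) unfolding inflation_inf_def by (rule UN_I[OF UNIV_I])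
      ultimately show ?thesis using Suc.IH[OF u(2)] by simp
    qed
  qed simp
qed

lemma regions_nested:
  assumes "finite (pverts G)" "region G U" "region G W" "U \<inter> W \<noteq> {}"
  shows "U \<subseteq> W \<or> W \<subseteq> U"
proof -
  obtain x y where U: "U = inflation_inf G {x}" and W: "W = inflation_inf G {y}"
    using assms(2,3) unfolding region_def by blast
  obtain z where "z \<in> U" "z \<in> W" using assms(4) by blast
  then have "x \<in> W \<or> y \<in> U"
    unfolding U W by (rule generator_in_region_if_meet)
  then show ?thesis
    using inflation_inf_least[OF assms(1), of "{x}" "{y}"]
      inflation_inf_least[OF assms(1), of "{y}" "{x}"]
    unfolding U W by auto
qed

lemma intervals_disjoint:
  assumes "finite (pverts G)" "interval G U" "interval G W" "U \<noteq> W"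
  shows "U \<inter> W = {}"
  using regions_nested[OF assms(1), of U W] assms(2-4) unfolding interval_def by blast

lemma region_subset_verts: "region G U \<Longrightarrow> U \<subseteq> pverts G"
  unfolding region_def by (elim bexE) (simp add: inflation_inf_subset_verts)

lemma region_nonempty: "region G U \<Longrightarrow> U \<noteq> {}"
  unfolding region_def by (elim bexE) (metis insert_not_empty subset_empty subset_inflation_inf)

lemma region_hyperinflation:
  assumes "region G U"
  shows "hyperinflation G U"
proof -
  obtain x where "{x} \<subseteq> pverts G" "U = inflation_inf G {x}"
    using assms unfolding region_def by auto
  then show ?thesis unfolding hyperinflation_def by (intro exI conjI)
qed

lemma ex_interval:
  assumes "finite (pverts G)" "v \<in> pverts G"
  obtains U where "interval G U" "v \<in> U"
proof -
  have "{U. region G U} \<subseteq> Pow (pverts G)" using region_subset_verts by auto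
  then have fin: "finite {U. region G U}" by (rule finite_subset) (simp add: assms(1))
  have "inflation_inf G {v} \<in> {U. region G U}" using assms(2) unfolding region_def by blast
  \<comment> \<open>An interval is a maximal element among the finitely many regions, so one is
    taken above the region generated by \<open>v\<close>.\<close>
  from finite_has_maximal2[OF fin this] obtain U where U: "region G U" "inflation_inf G {v} \<subseteq> U"
    and max: "\<And>W. region G W \<Longrightarrow> U \<subseteq> W \<Longrightarrow> U = W"
    by (metis mem_Collect_eq)
  have "interval G U" unfolding interval_def using U(1) max by metis
  moreover have "v \<in> U" using U(2) subset_inflation_inf[of "{v}" G] by auto
  ultimately show thesis by (rule that)
qed

definition induced_pair :: "'a pair_pre_digraph \<Rightarrow> 'a set \<Rightarrow> 'a pair_pre_digraph" where
  "induced_pair G U = \<lparr>pverts = U, parcs = {e \<in> parcs G. fst e \<in> U \<and> snd e \<in> U}\<rparr>"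

lemma pverts_induced_pair [simp]: "pverts (induced_pair G U) = U"
  by (simp add: induced_pair_def)

lemma induced_subgraph_induced_pair:
  assumes "pair_wf_digraph G" "U \<subseteq> pverts G"
  shows "induced_subgraph (with_proj (induced_pair G U)) (with_proj G)"
proof -
  have "wf_digraph (with_proj G)" "wf_digraph (with_proj (induced_pair G U))"
    using assms(1) unfolding wf_digraph_wp_iff pair_wf_digraph_def induced_pair_def by auto
  then show ?thesis
    using assms(2) unfolding induced_subgraph_def subgraph_def compatible_def
    by (auto simp: induced_pair_def)
qed

text \<open>A component is recovered from its vertex set, so uniqueness of a decomposition reduces
  to uniqueness of the collection of vertex sets.\<close>

lemma induced_pair_pverts:
  assumes "induced_subgraph (with_proj H) (with_proj G)"
  shows "induced_pair G (pverts H) = H"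
  using assms unfolding induced_subgraph_def induced_pair_def by (cases H) simp

theorem theorem2p1:
  fixes G :: "'a pair_pre_digraph"
  assumes "pair_wf_digraph G" and "finite (pverts G)"
  shows "\<exists>!D. decomposition G D \<and> (\<forall>H\<in>D. interval G (pverts H))"
proof (rule ex1I)
  let ?D = "induced_pair G ` {U. interval G U}"
  have int: "U \<subseteq> pverts G" "hyperinflation G U" if "interval G U" for U
  proof -
    have "region G U" using that unfolding interval_def by (rule conjunct1)
    then show "U \<subseteq> pverts G" "hyperinflation G U"
      by (rule region_subset_verts, rule region_hyperinflation)
  qed
  have "\<forall>H\<in>?D. induced_subgraph (with_proj H) (with_proj G) \<and> hyperinflation G (pverts H)"
    using int induced_subgraph_induced_pair[OF assms(1)] by simp
  moreover have "disjoint_family_on pverts ?D"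
    unfolding disjoint_family_on_def
  proof (intro ballI impI)
    fix H K assume "H \<in> ?D" "K \<in> ?D" "H \<noteq> K"
    \<comment> \<open>Members of \<open>?D\<close> are determined by their vertex sets, so distinct
      members are distinct intervals.\<close>
    then have "interval G (pverts H)" "interval G (pverts K)" "pverts H \<noteq> pverts K" by auto
    then show "pverts H \<inter> pverts K = {}" by (rule intervals_disjoint[OF assms(2)])
  qed
  moreover have "(\<Union>H\<in>?D. pverts H) = pverts G"
  proof
    show "(\<Union>H\<in>?D. pverts H) \<subseteq> pverts G" using int(1) by auto
    show "pverts G \<subseteq> (\<Union>H\<in>?D. pverts H)"
    proof
      fix v assume "v \<in> pverts G"
      then obtain U where "interval G U" "v \<in> U" by (rule ex_interval[OF assms(2)])
      then show "v \<in> (\<Union>H\<in>?D. pverts H)" by auto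
    qed
  qed
  ultimately show "decomposition G ?D \<and> (\<forall>H\<in>?D. interval G (pverts H))"
    unfolding decomposition_def by simp
next
  fix D assume D: "decomposition G D \<and> (\<forall>H\<in>D. interval G (pverts H))"
  then have eq: "induced_pair G (pverts H) = H" if "H \<in> D" for H
    using that unfolding decomposition_def by (simp add: induced_pair_pverts)
  \<comment> \<open>No interval can be missing: the component covering a vertex of \<open>U\<close>
    is itself an interval meeting \<open>U\<close>, hence equal to it.\<close>
  have "U \<in> pverts ` D" if U: "interval G U" for U
  proof -
    have "region G U" using U unfolding interval_def by blast
    then obtain v where v: "v \<in> U" "v \<in> pverts G"
      using region_nonempty[of G U] region_subset_verts[of G U] by blast
    then obtain H where H: "H \<in> D" "v \<in> pverts H"
      using D unfolding decomposition_def by blast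
    then have "interval G (pverts H)" "U \<inter> pverts H \<noteq> {}" using D v(1) by blast+
    then have "U = pverts H" using intervals_disjoint[OF assms(2) U] by blast
    then show ?thesis using H(1) by blast
  qed
  then have "pverts ` D = {U. interval G U}" using D by blast
  moreover have "induced_pair G ` pverts ` D = D" using eq by (simp add: image_image)
  ultimately show "D = induced_pair G ` {U. interval G U}" by simp
qed

end
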